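(* Fix $\rho\in\mathcal{C}$ and $P\in\mathcal{P}_d^\rho$. Then, for any $z\in\mathbb{R}^d$, $$MD^\rho(z,P)=\inf_{u\in\mathcal{S}^{d-1}}\frac{\mathrm{E}[|\psi_-(u'(Z-z))|\,\mathbb{I}[u'(Z-z)\leq0]]}{\mathrm{E}[|\psi_-(u'(Z-z))|]},$$ where $\psi_-$ is the left-derivative of $\rho$ and where $Z$ has distribution $P$.
   Context: A prime denotes transposition, $\mathbb{I}[A]$ is the indicator of $A$, $\mathcal{S}^{d-1}=\{z\in\mathbb{R}^d:\|z\|=1\}$, and $\sup\emptyset:=0$. $\mathcal{C}$ is the class of functions $\rho:\mathbb{R}\to\mathbb{R}^+$ that are convex, symmetric and such that $\rho(t)=0$ for $t=0$ only; $\psi_-$ is the left-derivative of $\rho$. For a probability measure $P$ over $\mathbb{R}^d$ and $u\in\mathcal{S}^{d-1}$, $P_u$ is the distribution of $u'Z$, where $Z$ has distribution $P$. $\mathcal{P}_d^\rho$ is the collection of probability measures $P$ over $\mathbb{R}^d$ such that no hyperplane of $\mathbb{R}^d$ has $P$-probability one and $\int|\psi_-(z-\theta)|\,dP_u(z)<\infty$ for any $\theta\in\mathbb{R}$ and $u\in\mathcal{S}^{d-1}$. For $P\in\mathcal{P}_d^\rho$ and $Z\sim P$, let $$G^\rho_u(\theta):=\frac{\mathrm{E}[|\psi_-(u'Z-\theta)|\,\mathbb{I}[u'Z\leq\theta]]}{\mathrm{E}[|\psi_-(u'Z-\theta)|]},\qquad \theta^\rho_\alpha(P_u):=\inf\{\theta\in\mathbb{R}:G_u^\rho(\theta)\geq\alpha\},\quad\alpha\in(0,1).$$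 Let $H^\rho_{\alpha,u}(P)=\{z\in\mathbb{R}^d:u'z\geq\theta^\rho_\alpha(P_u)\}$ and $R^\rho_\alpha(P)=\bigcap_{u\in\mathcal{S}^{d-1}}H^\rho_{\alpha,u}(P)$. The halfspace M-depth of $z$ with respect to $P$ is defined as $MD^\rho(z,P)=\sup\{\alpha\in(0,1):z\in R^\rho_\alpha(P)\}$. *)

theory Defs
  imports "HOL-Probability.Probability"
begin

definition loss_class :: "(real \<Rightarrow> real) set" where
  "loss_class = {\<rho>. (\<forall>t. \<rho> t \<ge> 0) \<and> convex_on UNIV \<rho> \<and> (\<forall>t. \<rho> (- t) = \<rho> t)
     \<and> (\<forall>t. \<rho> t = 0 \<longleftrightarrow> t = 0)}"

text \<open>Convex functions on the real line have a finite left-derivative everywhere, so the definite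
  description below is well defined for every member of \<^term>\<open>loss_class\<close>.\<close>

definition left_deriv :: "(real \<Rightarrow> real) \<Rightarrow> real \<Rightarrow> real" where
  "left_deriv f x = (THE D. (f has_real_derivative D) (at_left x))"

definition proj_distr :: "(real ^ 'd) measure \<Rightarrow> real ^ 'd \<Rightarrow> real measure" where
  "proj_distr P u = distr P borel (\<lambda>z. u \<bullet> z)"

definition M_measures :: "(real \<Rightarrow> real) \<Rightarrow> (real ^ 'd) measure set" where
  "M_measures \<rho> = {P. prob_space P \<and> sets P = sets borel
     \<and> (\<forall>a b. a \<noteq> 0 \<longrightarrow> measure P {z. a \<bullet> z = b} \<noteq> 1)
     \<and> (\<forall>\<theta>. \<forall>u \<in> sphere 0 1. integrable (proj_distr P u) (\<lambda>x. \<bar>left_deriv \<rho> (x - \<theta>)\<bar>))}"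

text \<open>The functions below depend on \<^term>\<open>Z\<close> only through its distribution \<^term>\<open>P\<close>, so expectations
  are written as integrals over \<^term>\<open>P\<close>.\<close>

definition M_cdf :: "(real \<Rightarrow> real) \<Rightarrow> (real ^ 'd) measure \<Rightarrow> real ^ 'd \<Rightarrow> real \<Rightarrow> real" where
  "M_cdf \<rho> P u \<theta> =
     (\<integral>z. \<bar>left_deriv \<rho> (u \<bullet> z - \<theta>)\<bar> * indicator {z. u \<bullet> z \<le> \<theta>} z \<partial>P)
     / (\<integral>z. \<bar>left_deriv \<rho> (u \<bullet> z - \<theta>)\<bar> \<partial>P)"

text \<open>For \<^term>\<open>\<rho>\<close> in \<^term>\<open>loss_class\<close>, \<^term>\<open>P\<close> in \<^term>\<open>M_measures \<rho>\<close>, unit \<^term>\<open>u\<close> and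
  \<open>0 < \<alpha> < 1\<close>, the set below is nonempty and bounded below, because \<^term>\<open>M_cdf \<rho> P u\<close>
  is nondecreasing and tends to 0 and 1 at minus and plus infinity; hence the real
  \<^term>\<open>Inf\<close> is the actual infimum.\<close>

definition M_quantile :: "(real \<Rightarrow> real) \<Rightarrow> real \<Rightarrow> (real ^ 'd) measure \<Rightarrow> real ^ 'd \<Rightarrow> real" where
  "M_quantile \<rho> \<alpha> P u = Inf {\<theta>. M_cdf \<rho> P u \<theta> \<ge> \<alpha>}"

definition M_halfspace :: "(real \<Rightarrow> real) \<Rightarrow> real \<Rightarrow> real ^ 'd \<Rightarrow> (real ^ 'd) measure \<Rightarrow> (real ^ 'd) set" where
  "M_halfspace \<rho> \<alpha> u P = {z. u \<bullet> z \<ge> M_quantile \<rho> \<alpha> P u}"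

definition M_region :: "(real \<Rightarrow> real) \<Rightarrow> real \<Rightarrow> (real ^ 'd) measure \<Rightarrow> (real ^ 'd) set" where
  "M_region \<rho> \<alpha> P = (\<Inter>u \<in> sphere 0 1. M_halfspace \<rho> \<alpha> u P)"

text \<open>Supremum with the convention that the supremum of the empty set is 0; the library's
  \<^term>\<open>Sup {} :: real\<close> is unspecified.\<close>

definition sup0 :: "real set \<Rightarrow> real" where
  "sup0 A = (if A = {} then 0 else Sup A)"

definition M_depth :: "(real \<Rightarrow> real) \<Rightarrow> real ^ 'd \<Rightarrow> (real ^ 'd) measure \<Rightarrow> real" where
  "M_depth \<rho> z P = sup0 {\<alpha> \<in> {0<..<1}. z \<in> M_region \<rho> \<alpha> P}"

end

theory Submission
  imports Defs
begin

text \<open>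
  Write \<open>\<psi>\<close> for the left-derivative of \<open>\<rho>\<close>. It is nondecreasing and left-continuous, negative on
  the negative reals, positive on the positive reals and nonpositive at 0. Hence, for a unit vector
  \<open>u\<close>, the numerator of \<^term>\<open>M_cdf \<rho> P u \<theta>\<close> is the mean \<open>L \<theta>\<close> of the negative part of
  \<open>\<psi> (u \<bullet> Z - \<theta>)\<close>, and the denominator is \<open>L \<theta> + U \<theta>\<close>, where \<open>U \<theta>\<close> is the mean of the positive
  part. In \<open>\<theta>\<close>, \<open>L\<close> is nondecreasing and \<open>U\<close> is nonincreasing. Both are right-continuous, because
  \<open>\<psi>\<close> is left-continuous and its argument decreases in \<open>\<theta>\<close>. Dominated convergence gives
  \<open>L \<theta> \<longrightarrow> 0\<close> at minus infinity and \<open>U \<theta> \<longrightarrow> 0\<close> at plus infinity. The sum is never 0, since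
  \<open>u \<bullet> Z\<close> is not almost surely constant. So \<open>L / (L + U)\<close> is a genuine cumulative distribution
  function, and its quantiles satisfy the usual Galois connection: the \<open>\<alpha>\<close>-quantile is at most \<open>t\<close>
  iff \<open>\<alpha>\<close> is at most the value at \<open>t\<close> (\<open>M_quantile_le_iff\<close> below).

  Consequently \<open>z\<close> lies in the region of order \<open>\<alpha>\<close> iff \<open>\<alpha> \<le> M_cdf \<rho> P u (u \<bullet> z)\<close> for all unit
  \<open>u\<close>, that is, iff \<open>\<alpha>\<close> is at most the infimum \<open>I\<close> of these numbers. The depth is then the supremum
  of the \<open>\<alpha>\<close> in \<open>(0,1)\<close> with \<open>\<alpha> \<le> I\<close>; as \<open>0 \<le> I \<le> 1\<close>, this is \<open>I\<close>. The convention for the supremum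
  of the empty set covers the case \<open>I = 0\<close>. Since \<open>u \<bullet> (Z - z) = u \<bullet> Z - u \<bullet> z\<close>, the number
  \<^term>\<open>M_cdf \<rho> P u (u \<bullet> z)\<close> is the ratio of expectations in the theorem.
\<close>

section \<open>Left-derivatives of convex functions\<close>

lemma convex_slope_mono:
  fixes f :: "real \<Rightarrow> real"
  assumes "convex_on UNIV f" "s \<le> t" "t < x"
  shows "(f x - f s) / (x - s) \<le> (f x - f t) / (x - t)"
proof (cases "s = t")
  case False
  then have "(f s - f x) / (s - x) \<le> (f t - f x) / (t - x)"
    using convex_on_slope_le(2)[OF assms(1), of s x t] assms by simp
  moreover have "(f s - f x) / (s - x) = (f x - f s) / (x - s)"
    "(f t - f x) / (t - x) = (f x - f t) / (x - t)"
    by (metis minus_diff_eq minus_divide_divide)+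
  ultimately show ?thesis by simp
qed simp

lemma convex_slope_le_slope:
  fixes f :: "real \<Rightarrow> real"
  assumes "convex_on UNIV f" "s < x" "x < y"
  shows "(f x - f s) / (x - s) \<le> (f y - f x) / (y - x)"
proof -
  have "(f s - f x) / (s - x) \<le> (f s - f y) / (s - y)"
    "(f s - f y) / (s - y) \<le> (f x - f y) / (x - y)"
    using convex_on_slope_le[OF assms(1), of s y x] assms by auto
  moreover have "(f s - f x) / (s - x) = (f x - f s) / (x - s)"
    "(f x - f y) / (x - y) = (f y - f x) / (y - x)"
    by (metis minus_diff_eq minus_divide_divide)+
  ultimately show ?thesis by linarith
qed

lemma bdd_above_convex_slopes:
  fixes f :: "real \<Rightarrow> real"
  assumes "convex_on UNIV f"
  shows "bdd_above ((\<lambda>s. (f x - f s) / (x - s)) ` {..<x})"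
  using convex_slope_le_slope[OF assms, of _ x "x + 1"]
  by (intro bdd_aboveI[of _ "(f (x + 1) - f x) / (x + 1 - x)"]) auto

text \<open>The slopes of the chords from the left increase as their left endpoint approaches \<open>x\<close>, so
  their limit is their supremum.\<close>

lemma left_deriv_convex:
  fixes f :: "real \<Rightarrow> real"
  assumes "convex_on UNIV f"
  shows "left_deriv f x = (SUP s\<in>{..<x}. (f x - f s) / (x - s))" (is "_ = ?D")
proof -
  let ?q = "\<lambda>s. (f x - f s) / (x - s)"
  note bdd = bdd_above_convex_slopes[OF assms, of x]
  have "(?q \<longlongrightarrow> ?D) (at_left x)"
  proof (rule increasing_tendsto)
    show "eventually (\<lambda>s. ?q s \<le> ?D) (at_left x)"
      unfolding eventually_at_left_field
      by (rule exI[of _ "x - 1"]) (auto intro!: cSUP_upper bdd)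
    fix l assume "l < ?D"
    then obtain s where s: "s < x" "l < ?q s"
      using less_cSUP_iff[OF _ bdd, of l] by auto
    have "l < ?q t" if "s < t" "t < x" for t
      using convex_slope_mono[OF assms, of s t x] s that by linarith
    then show "eventually (\<lambda>t. l < ?q t) (at_left x)"
      unfolding eventually_at_left_field using s(1) by blast
  qed
  moreover have "?q = (\<lambda>s. (f s - f x) / (s - x))"
    by (rule ext) (metis minus_diff_eq minus_divide_divide)
  ultimately have D: "(f has_real_derivative ?D) (at_left x)"
    by (simp add: has_field_derivative_iff)
  moreover have "E = ?D" if "(f has_real_derivative E) (at_left x)" for E
    using that D unfolding has_field_derivative_iff
    by (rule tendsto_unique[rotated]) simp
  ultimately show ?thesis
    unfolding left_deriv_def by (rule the_equality)
qed

lemma chord_slope_le_left_deriv: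
  fixes f :: "real \<Rightarrow> real"
  assumes "convex_on UNIV f" "s < x"
  shows "(f x - f s) / (x - s) \<le> left_deriv f x"
  using assms by (auto simp: left_deriv_convex intro!: cSUP_upper bdd_above_convex_slopes)

lemma left_deriv_le_chord_slope:
  fixes f :: "real \<Rightarrow> real"
  assumes "convex_on UNIV f" "x < y"
  shows "left_deriv f x \<le> (f y - f x) / (y - x)"
  using assms by (auto simp: left_deriv_convex intro!: cSUP_least convex_slope_le_slope)

lemma mono_left_deriv:
  fixes f :: "real \<Rightarrow> real"
  assumes "convex_on UNIV f"
  shows "mono (left_deriv f)"
proof (rule monoI)
  fix x y :: real assume "x \<le> y"
  then show "left_deriv f x \<le> left_deriv f y"
    using left_deriv_le_chord_slope[OF assms, of x y] chord_slope_le_left_deriv[OF assms, of x y]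
    by (cases "x = y") auto
qed

text \<open>Each chord slope is continuous in its right endpoint and bounds the left-derivative there from
  below. A supremum of continuous functions is lower semicontinuous, which for a nondecreasing
  function means left-continuous.\<close>

lemma left_deriv_left_continuous:
  fixes f :: "real \<Rightarrow> real"
  assumes "convex_on UNIV f"
  shows "(left_deriv f \<longlongrightarrow> left_deriv f x) (at_left x)"
proof (rule increasing_tendsto)
  show "eventually (\<lambda>t. left_deriv f t \<le> left_deriv f x) (at_left x)"
    unfolding eventually_at_left_field
    by (rule exI[of _ "x - 1"]) (auto intro!: monoD[OF mono_left_deriv[OF assms]])
  fix l assume "l < left_deriv f x"
  then obtain s where s: "s < x" "l < (f x - f s) / (x - s)"
    using less_cSUP_iff[OF _ bdd_above_convex_slopes[OF assms], of x l]
    by (auto simp: left_deriv_convex[OF assms])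
  have "continuous_on UNIV f"
    by (intro convex_on_continuous assms) auto
  then have "(f \<longlongrightarrow> f x) (at x)"
    by (auto simp: continuous_on_def)
  then have "(f \<longlongrightarrow> f x) (at_left x)"
    by (rule filterlim_mono) (auto intro: at_le)
  then have "((\<lambda>t. (f t - f s) / (t - s)) \<longlongrightarrow> (f x - f s) / (x - s)) (at_left x)"
    using s by (intro tendsto_intros) auto
  then have "eventually (\<lambda>t. l < (f t - f s) / (t - s)) (at_left x)"
    using s(2) by (rule order_tendstoD)
  moreover have "eventually (\<lambda>t. s < t) (at_left x)"
    unfolding eventually_at_left_field using s(1) by blast
  ultimately show "eventually (\<lambda>t. l < left_deriv f t) (at_left x)"
    by eventually_elim (use chord_slope_le_left_deriv[OF assms] in force)
qed

section \<open>The distribution function of a score\<close>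

text \<open>One-dimensional setting: \<open>\<psi>\<close> plays the part of the left-derivative of the loss, and \<open>M\<close> that
  of the distribution of a projection \<open>u \<bullet> Z\<close>.\<close>

locale score_distribution = real_distribution M for M +
  fixes \<psi> :: "real \<Rightarrow> real"
  assumes mono_score: "mono \<psi>"
    and score_left_continuous: "(\<psi> \<longlongrightarrow> \<psi> x) (at_left x)"
    and score_neg: "x < 0 \<Longrightarrow> \<psi> x < 0"
    and score_pos: "x > 0 \<Longrightarrow> \<psi> x > 0"
    and integrable_score: "integrable M (\<lambda>x. \<bar>\<psi> (x - \<theta>)\<bar>)"
    and not_constant: "prob {\<theta>} \<noteq> 1"
begin

definition lower :: "real \<Rightarrow> real" where
  "lower \<theta> = (\<integral>x. max 0 (- \<psi> (x - \<theta>)) \<partial>M)"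

definition upper :: "real \<Rightarrow> real" where
  "upper \<theta> = (\<integral>x. max 0 (\<psi> (x - \<theta>)) \<partial>M)"

definition score_cdf :: "real \<Rightarrow> real" where
  "score_cdf \<theta> = lower \<theta> / (lower \<theta> + upper \<theta>)"

text \<open>The value at 0 may be 0 or negative. In either case \<open>\<psi>\<close> is nonpositive exactly on the closed half
  line, which is why the event \<open>u \<bullet> Z \<le> \<theta>\<close> in the definition of the distribution function can be
  traded for the negative part of the score.\<close>

lemma score_nonpos: "x \<le> 0 \<Longrightarrow> \<psi> x \<le> 0"
proof -
  have "eventually (\<lambda>t. \<psi> t \<le> 0) (at_left 0)"
    unfolding eventually_at_left_field
    by (rule exI[of _ "-1"]) (auto intro: less_imp_le score_neg)
  then have "\<psi> 0 \<le> 0"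
    by (intro tendsto_upperbound[OF score_left_continuous]) auto
  then show "x \<le> 0 \<Longrightarrow> \<psi> x \<le> 0"
    using monoD[OF mono_score, of x 0] by linarith
qed

lemma score_measurable [measurable]: "\<psi> \<in> borel_measurable borel"
  by (rule borel_measurable_mono[OF mono_score])

lemma integrable_lower: "integrable M (\<lambda>x. max 0 (- \<psi> (x - \<theta>)))"
  by (rule Bochner_Integration.integrable_bound[OF integrable_score[of \<theta>]]) auto

lemma integrable_upper: "integrable M (\<lambda>x. max 0 (\<psi> (x - \<theta>)))"
  by (rule Bochner_Integration.integrable_bound[OF integrable_score[of \<theta>]]) auto

lemma lower_nonneg: "0 \<le> lower \<theta>" and upper_nonneg: "0 \<le> upper \<theta>"
  unfolding lower_def upper_def by (auto intro!: integral_nonneg_AE)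

lemma lower_mono: "\<theta> \<le> \<eta> \<Longrightarrow> lower \<theta> \<le> lower \<eta>"
  unfolding lower_def
  by (intro integral_mono integrable_lower max.mono) (auto intro!: monoD[OF mono_score])

lemma upper_antimono: "\<theta> \<le> \<eta> \<Longrightarrow> upper \<eta> \<le> upper \<theta>"
  unfolding upper_def
  by (intro integral_mono integrable_upper max.mono) (auto intro!: monoD[OF mono_score])

lemma lower_eq_0D:
  assumes "lower \<theta> = 0" shows "AE x in M. \<theta> \<le> x"
proof -
  have "AE x in M. max 0 (- \<psi> (x - \<theta>)) = 0"
    using assms unfolding lower_def
    by (subst (asm) integral_nonneg_eq_0_iff_AE[OF integrable_lower]) simp_all
  then show ?thesis
  proof eventually_elim
    case (elim x)
    then show ?case using score_neg[of "x - \<theta>"] by linarith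
  qed
qed

lemma upper_eq_0D:
  assumes "upper \<theta> = 0" shows "AE x in M. x \<le> \<theta>"
proof -
  have "AE x in M. max 0 (\<psi> (x - \<theta>)) = 0"
    using assms unfolding upper_def
    by (subst (asm) integral_nonneg_eq_0_iff_AE[OF integrable_upper]) simp_all
  then show ?thesis
  proof eventually_elim
    case (elim x)
    then show ?case using score_pos[of "x - \<theta>"] by linarith
  qed
qed

lemma total_pos: "0 < lower \<theta> + upper \<theta>"
proof (rule ccontr)
  assume "\<not> ?thesis"
  then have "lower \<theta> = 0" "upper \<theta> = 0"
    using lower_nonneg[of \<theta>] upper_nonneg[of \<theta>] by linarith+
  from lower_eq_0D[OF this(1)] upper_eq_0D[OF this(2)] have "AE x in M. x \<in> {\<theta>}"
    by eventually_elim auto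
  then have "prob {\<theta>} = 1"
    by (subst prob_eq_1) auto
  with not_constant show False by blast
qed

lemma score_cdf_nonneg: "0 \<le> score_cdf \<theta>"
  and score_cdf_le_1: "score_cdf \<theta> \<le> 1"
  using total_pos[of \<theta>] lower_nonneg[of \<theta>] upper_nonneg[of \<theta>]
  by (auto simp: score_cdf_def field_simps)

text \<open>Clearing the denominator turns the ratio into a comparison of \<open>upper\<close> with \<open>lower\<close>, whose
  monotonicity and limits are known separately.\<close>

lemma le_score_cdf_iff: "\<alpha> \<le> score_cdf \<theta> \<longleftrightarrow> \<alpha> * upper \<theta> \<le> (1 - \<alpha>) * lower \<theta>"
  using total_pos[of \<theta>] by (auto simp: score_cdf_def pos_le_divide_eq algebra_simps)

lemma score_cdf_mono:
  assumes "\<theta> \<le> \<eta>" shows "score_cdf \<theta> \<le> score_cdf \<eta>"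
proof -
  let ?a = "score_cdf \<theta>"
  have "?a * upper \<eta> \<le> ?a * upper \<theta>"
    using assms by (intro mult_left_mono upper_antimono score_cdf_nonneg)
  also have "\<dots> \<le> (1 - ?a) * lower \<theta>"
    using le_score_cdf_iff[of ?a \<theta>] by simp
  also have "\<dots> \<le> (1 - ?a) * lower \<eta>"
    using assms score_cdf_le_1[of \<theta>] by (intro mult_left_mono lower_mono) auto
  finally show ?thesis by (simp add: le_score_cdf_iff)
qed

text \<open>Dominated convergence: for \<open>\<theta>\<close> between \<open>q\<close> and \<open>q + 1\<close>, monotonicity puts \<open>\<psi> (x - \<theta>)\<close> between
  its values at these two endpoints, so the sum of their absolute values is an integrable majorant.\<close>

lemma
  shows lower_right_continuous: "(\<lambda>n. lower (q + inverse (real (Suc n)))) \<longlonglongrightarrow> lower q"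
    and upper_right_continuous: "(\<lambda>n. upper (q + inverse (real (Suc n)))) \<longlonglongrightarrow> upper q"
proof -
  let ?e = "\<lambda>n. inverse (real (Suc n))"
  let ?w = "\<lambda>x. \<bar>\<psi> (x - q)\<bar> + \<bar>\<psi> (x - (q + 1))\<bar>"
  have w: "integrable M ?w"
    by (intro Bochner_Integration.integrable_add integrable_score)
  have bound: "\<bar>\<psi> (x - (q + ?e n))\<bar> \<le> ?w x" for x n
  proof -
    have "?e n \<le> 1" "0 \<le> ?e n" by (auto simp: field_simps)
    then have "\<psi> (x - (q + 1)) \<le> \<psi> (x - (q + ?e n))" "\<psi> (x - (q + ?e n)) \<le> \<psi> (x - q)"
      by (auto intro!: monoD[OF mono_score])
    then show ?thesis by linarith
  qed
  have lim: "(\<lambda>n. \<psi> (x - (q + ?e n))) \<longlonglongrightarrow> \<psi> (x - q)" for x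
  proof (rule filterlim_compose[OF score_left_continuous])
    have "(\<lambda>n. x - (q + ?e n)) \<longlonglongrightarrow> x - (q + 0)"
      by (intro tendsto_intros LIMSEQ_inverse_real_of_nat)
    then show "filterlim (\<lambda>n. x - (q + ?e n)) (at_left (x - q)) sequentially"
      by (auto simp: filterlim_at)
  qed
  show "(\<lambda>n. lower (q + ?e n)) \<longlonglongrightarrow> lower q"
    unfolding lower_def
  proof (rule integral_dominated_convergence[OF _ _ w])
    show "AE x in M. (\<lambda>n. max 0 (- \<psi> (x - (q + ?e n)))) \<longlonglongrightarrow> max 0 (- \<psi> (x - q))"
      by (intro AE_I2 tendsto_intros lim)
    show "AE x in M. norm (max 0 (- \<psi> (x - (q + ?e n)))) \<le> ?w x" for n
      using bound[of _ n] by (intro AE_I2) (smt (verit) real_norm_def)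
  qed auto
  show "(\<lambda>n. upper (q + ?e n)) \<longlonglongrightarrow> upper q"
    unfolding upper_def
  proof (rule integral_dominated_convergence[OF _ _ w])
    show "AE x in M. (\<lambda>n. max 0 (\<psi> (x - (q + ?e n)))) \<longlonglongrightarrow> max 0 (\<psi> (x - q))"
      by (intro AE_I2 tendsto_intros lim)
    show "AE x in M. norm (max 0 (\<psi> (x - (q + ?e n)))) \<le> ?w x" for n
      using bound[of _ n] by (intro AE_I2) (smt (verit) real_norm_def)
  qed auto
qed

text \<open>For fixed \<open>x\<close> the negative part of \<open>\<psi> (x - \<theta>)\<close> vanishes once \<open>\<theta> < x\<close>, and the positive part
  once \<open>\<theta> \<ge> x\<close>.\<close>

lemma lower_at_bot: "(\<lambda>n. lower (- real n)) \<longlonglongrightarrow> 0"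
proof -
  have "(\<lambda>n. lower (- real n)) \<longlonglongrightarrow> (\<integral>x. 0 \<partial>M)"
    unfolding lower_def
  proof (rule integral_dominated_convergence[OF _ _ integrable_lower[of 0]])
    have "(\<lambda>n. max 0 (- \<psi> (x - - real n))) \<longlonglongrightarrow> 0" for x
    proof (rule tendsto_eventually, unfold eventually_sequentially, intro exI allI impI)
      fix n assume "nat \<lceil>- x\<rceil> + 1 \<le> n"
      then have "0 < x - - real n" by linarith
      then show "max 0 (- \<psi> (x - - real n)) = 0"
        using score_pos by (simp add: less_imp_le)
    qed
    then show "AE x in M. (\<lambda>n. max 0 (- \<psi> (x - - real n))) \<longlonglongrightarrow> 0"
      by simp
    show "AE x in M. norm (max 0 (- \<psi> (x - - real n))) \<le> max 0 (- \<psi> (x - 0))" for n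
    proof (rule AE_I2)
      fix x
      have "\<psi> (x - 0) \<le> \<psi> (x - - real n)"
        by (intro monoD[OF mono_score]) auto
      then show "norm (max 0 (- \<psi> (x - - real n))) \<le> max 0 (- \<psi> (x - 0))"
        by (auto simp: max_def)
    qed
  qed auto
  then show ?thesis by simp
qed

lemma upper_at_top: "(\<lambda>n. upper (real n)) \<longlonglongrightarrow> 0"
proof -
  have "(\<lambda>n. upper (real n)) \<longlonglongrightarrow> (\<integral>x. 0 \<partial>M)"
    unfolding upper_def
  proof (rule integral_dominated_convergence[OF _ _ integrable_upper[of 0]])
    have "(\<lambda>n. max 0 (\<psi> (x - real n))) \<longlonglongrightarrow> 0" for x
    proof (rule tendsto_eventually, unfold eventually_sequentially, intro exI allI impI)
      fix n assume "nat \<lceil>x\<rceil> \<le> n"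
      then have "x - real n \<le> 0" by linarith
      then show "max 0 (\<psi> (x - real n)) = 0"
        using score_nonpos by (simp add: max_def order_antisym)
    qed
    then show "AE x in M. (\<lambda>n. max 0 (\<psi> (x - real n))) \<longlonglongrightarrow> 0"
      by simp
    show "AE x in M. norm (max 0 (\<psi> (x - real n))) \<le> max 0 (\<psi> (x - 0))" for n
    proof (rule AE_I2)
      fix x
      have "\<psi> (x - real n) \<le> \<psi> (x - 0)"
        by (intro monoD[OF mono_score]) auto
      then show "norm (max 0 (\<psi> (x - real n))) \<le> max 0 (\<psi> (x - 0))"
        by (auto simp: max_def)
    qed
  qed auto
  then show ?thesis by simp
qed

lemma ex_upper_pos: "\<exists>n. 0 < upper (- real n)"
proof (rule ccontr)
  assume "\<not> ?thesis"
  then have "AE x in M. x \<le> - real n" for n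
    using upper_nonneg[of "- real n"] by (intro upper_eq_0D) (auto simp: not_less intro: order_antisym)
  then have "AE x in M. \<forall>n. x \<le> - real n"
    by (simp add: AE_all_countable)
  then have "AE x in M. False"
  proof eventually_elim
    case (elim x)
    obtain n where "- x < real n" using reals_Archimedean2 by blast
    with elim[rule_format, of n] show False by linarith
  qed
  then show False by simp
qed

lemma ex_lower_pos: "\<exists>n. 0 < lower (real n)"
proof (rule ccontr)
  assume "\<not> ?thesis"
  then have "AE x in M. real n \<le> x" for n
    using lower_nonneg[of "real n"] by (intro lower_eq_0D) (auto simp: not_less intro: order_antisym)
  then have "AE x in M. \<forall>n. real n \<le> x"
    by (simp add: AE_all_countable)
  then have "AE x in M. False"
  proof eventually_elim
    case (elim x)
    obtain n where "x < real n" using reals_Archimedean2 by blast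
    with elim[rule_format, of n] show False by linarith
  qed
  then show False by simp
qed

text \<open>Far to the left \<open>lower\<close> is arbitrarily small while \<open>upper\<close> stays bounded away from 0; far to the
  right the roles are exchanged.\<close>

lemma ex_score_cdf_less:
  assumes "0 < \<alpha>" "\<alpha> < 1" shows "\<exists>\<theta>. score_cdf \<theta> < \<alpha>"
proof -
  obtain m where m: "0 < upper (- real m)" using ex_upper_pos by blast
  have "eventually (\<lambda>n. lower (- real n) < \<alpha> * upper (- real m)) sequentially"
    using order_tendstoD(2)[OF lower_at_bot] m assms by simp
  then obtain n where n: "n \<ge> m" "lower (- real n) < \<alpha> * upper (- real m)"
    unfolding eventually_sequentially by (metis nat_le_linear)
  have "(1 - \<alpha>) * lower (- real n) \<le> lower (- real n)"
    using assms lower_nonneg by (intro mult_left_le_one_le) auto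
  also have "\<dots> < \<alpha> * upper (- real m)" by (rule n)
  also have "\<dots> \<le> \<alpha> * upper (- real n)"
    using n assms by (intro mult_left_mono upper_antimono) auto
  finally have "\<not> \<alpha> \<le> score_cdf (- real n)"
    by (simp add: le_score_cdf_iff)
  then show ?thesis by (metis not_le)
qed

lemma ex_le_score_cdf:
  assumes "0 < \<alpha>" "\<alpha> < 1" shows "\<exists>\<theta>. \<alpha> \<le> score_cdf \<theta>"
proof -
  obtain m where m: "0 < lower (real m)" using ex_lower_pos by blast
  have "eventually (\<lambda>n. upper (real n) < (1 - \<alpha>) * lower (real m)) sequentially"
    using order_tendstoD(2)[OF upper_at_top] m assms by simp
  then obtain n where n: "n \<ge> m" "upper (real n) < (1 - \<alpha>) * lower (real m)"
    unfolding eventually_sequentially by (metis nat_le_linear)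
  have "\<alpha> * upper (real n) \<le> upper (real n)"
    using assms upper_nonneg by (intro mult_left_le_one_le) auto
  also have "\<dots> \<le> (1 - \<alpha>) * lower (real m)" using n by simp
  also have "\<dots> \<le> (1 - \<alpha>) * lower (real n)"
    using n assms by (intro mult_left_mono lower_mono) auto
  finally show ?thesis
    by (auto simp: le_score_cdf_iff)
qed

text \<open>The Galois connection between quantiles and distribution function. Right-continuity is what
  makes the infimum defining the quantile attained.\<close>

lemma score_quantile_le_iff:
  assumes "0 < \<alpha>" "\<alpha> < 1"
  shows "Inf {\<theta>. \<alpha> \<le> score_cdf \<theta>} \<le> t \<longleftrightarrow> \<alpha> \<le> score_cdf t"
proof -
  let ?A = "{\<theta>. \<alpha> \<le> score_cdf \<theta>}"
  let ?q = "Inf ?A"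
  have ne: "?A \<noteq> {}"
    using ex_le_score_cdf[OF assms] by blast
  obtain b where b: "score_cdf b < \<alpha>"
    using ex_score_cdf_less[OF assms] by blast
  have bdd: "bdd_below ?A"
  proof (rule bdd_belowI[of _ b])
    fix \<theta> assume "\<theta> \<in> ?A"
    then have "score_cdf b < score_cdf \<theta>" using b by simp
    then show "b \<le> \<theta>" using score_cdf_mono[of \<theta> b] by linarith
  qed
  have right: "\<alpha> * upper (?q + inverse (real (Suc n))) \<le> (1 - \<alpha>) * lower (?q + inverse (real (Suc n)))" for n
  proof -
    obtain \<theta> where "\<theta> \<in> ?A" "\<theta> < ?q + inverse (real (Suc n))"
      using cInf_lessD[OF ne, of "?q + inverse (real (Suc n))"] by auto
    then have "\<alpha> \<le> score_cdf (?q + inverse (real (Suc n)))"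
      using score_cdf_mono[of \<theta> "?q + inverse (real (Suc n))"] by simp
    then show ?thesis by (simp only: le_score_cdf_iff)
  qed
  have "\<alpha> * upper ?q \<le> (1 - \<alpha>) * lower ?q"
    by (rule LIMSEQ_le[OF tendsto_mult_left[OF upper_right_continuous]
          tendsto_mult_left[OF lower_right_continuous]])
       (use right in blast)
  then have "\<alpha> \<le> score_cdf ?q"
    by (simp add: le_score_cdf_iff)
  then show ?thesis
    using score_cdf_mono[of ?q t] cInf_lower[OF _ bdd, of t] by auto
qed

end

section \<open>Quantiles of projections and halfspace depth\<close>

text \<open>Compare with the slope of the chord to the origin, where \<open>\<rho>\<close> vanishes and is minimal.\<close>

lemma left_deriv_loss_class:
  assumes "\<rho> \<in> loss_class"
  shows "x < 0 \<Longrightarrow> left_deriv \<rho> x < 0" and "x > 0 \<Longrightarrow> left_deriv \<rho> x > 0"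
proof -
  have conv: "convex_on UNIV \<rho>" and zero: "\<rho> 0 = 0" and pos: "x \<noteq> 0 \<Longrightarrow> \<rho> x > 0" for x
    using assms by (auto simp: loss_class_def less_le)
  show "left_deriv \<rho> x < 0" if "x < 0"
    using left_deriv_le_chord_slope[OF conv that] pos[of x] zero that
    by (smt (verit) divide_neg_pos)
  show "left_deriv \<rho> x > 0" if "x > 0"
    using chord_slope_le_left_deriv[OF conv that] pos[of x] zero that
    by (smt (verit) divide_pos_pos)
qed

text \<open>A point mass at \<open>\<theta>\<close> for the projection would put all of \<open>P\<close> on the hyperplane \<open>u \<bullet> z = \<theta>\<close>.\<close>

lemma score_distribution_proj_distr:
  assumes \<rho>: "\<rho> \<in> loss_class" and P: "P \<in> M_measures \<rho>" and u: "u \<in> sphere 0 1"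
  shows "score_distribution (proj_distr P u) (left_deriv \<rho>)"
proof -
  interpret P: prob_space P
    using P by (simp add: M_measures_def)
  have [measurable_cong]: "sets P = sets borel"
    using P by (simp add: M_measures_def)
  then have [simp]: "space P = UNIV"
    using sets_eq_imp_space_eq by fastforce
  have meas: "(\<lambda>z. u \<bullet> z) \<in> measurable P borel"
    by measurable
  interpret real_distribution "proj_distr P u"
    unfolding proj_distr_def by (rule P.real_distribution_distr) measurable
  have conv: "convex_on UNIV \<rho>"
    using \<rho> by (simp add: loss_class_def)
  have "u \<noteq> 0" using u by auto
  then have "measure (proj_distr P u) {\<theta>} \<noteq> 1" for \<theta>
    using P meas by (auto simp: proj_distr_def measure_distr M_measures_def vimage_def)
  moreover have "integrable (proj_distr P u) (\<lambda>x. \<bar>left_deriv \<rho> (x - \<theta>)\<bar>)" for \<theta>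
    using P u by (simp add: M_measures_def)
  ultimately show ?thesis
    by unfold_locales
       (auto intro: mono_left_deriv[OF conv] left_deriv_left_continuous[OF conv]
          left_deriv_loss_class[OF \<rho>])
qed

lemma M_cdf_eq_score_cdf:
  assumes \<rho>: "\<rho> \<in> loss_class" and P: "P \<in> M_measures \<rho>" and u: "u \<in> sphere 0 1"
  shows "M_cdf \<rho> P u \<theta> = score_distribution.score_cdf (proj_distr P u) (left_deriv \<rho>) \<theta>"
proof -
  interpret score_distribution "proj_distr P u" "left_deriv \<rho>"
    by (rule score_distribution_proj_distr[OF assms])
  have [measurable_cong]: "sets P = sets borel"
    using P by (simp add: M_measures_def)
  have num: "\<bar>left_deriv \<rho> (u \<bullet> z - \<theta>)\<bar> * indicator {z. u \<bullet> z \<le> \<theta>} z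
      = max 0 (- left_deriv \<rho> (u \<bullet> z - \<theta>))" for z
    using score_nonpos[of "u \<bullet> z - \<theta>"] score_pos[of "u \<bullet> z - \<theta>"]
    by (auto simp: indicator_def max_def)
  have "lower \<theta> + upper \<theta> = (\<integral>x. \<bar>left_deriv \<rho> (x - \<theta>)\<bar> \<partial>proj_distr P u)"
    unfolding lower_def upper_def
    by (subst Bochner_Integration.integral_add[OF integrable_lower integrable_upper, symmetric])
       (auto intro!: Bochner_Integration.integral_cong)
  then show ?thesis
    unfolding M_cdf_def score_cdf_def num lower_def
    by (simp add: proj_distr_def integral_distr)
qed

lemma M_cdf_bounds:
  assumes "\<rho> \<in> loss_class" "P \<in> M_measures \<rho>" "u \<in> sphere 0 1"
  shows "0 \<le> M_cdf \<rho> P u \<theta>" "M_cdf \<rho> P u \<theta> \<le> 1"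
  unfolding M_cdf_eq_score_cdf[OF assms]
  by (intro score_distribution.score_cdf_nonneg score_distribution.score_cdf_le_1
        score_distribution_proj_distr[OF assms])+

lemma M_quantile_le_iff:
  assumes "\<rho> \<in> loss_class" "P \<in> M_measures \<rho>" "u \<in> sphere 0 1" "0 < \<alpha>" "\<alpha> < 1"
  shows "M_quantile \<rho> \<alpha> P u \<le> t \<longleftrightarrow> \<alpha> \<le> M_cdf \<rho> P u t"
  unfolding M_quantile_def M_cdf_eq_score_cdf[OF assms(1-3)]
  by (rule score_distribution.score_quantile_le_iff[OF score_distribution_proj_distr])
     (use assms in auto)

lemma sup0_unit_interval:
  assumes "0 \<le> c" "c \<le> 1"
  shows "sup0 {\<alpha> \<in> {0<..<1}. \<alpha> \<le> c} = c"
proof (cases "c = 0")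
  case False
  have "Sup {\<alpha> \<in> {0<..<1}. \<alpha> \<le> c} = c"
  proof (rule cSup_eq)
    fix y assume y: "\<And>\<alpha>. \<alpha> \<in> {\<alpha> \<in> {0<..<1}. \<alpha> \<le> c} \<Longrightarrow> \<alpha> \<le> y"
    show "c \<le> y"
    proof (rule dense_le_bounded)
      show "0 < c" using assms False by simp
      fix w assume "0 < w" "w < c"
      then show "w \<le> y" using assms by (intro y) auto
    qed
  qed auto
  moreover have "c / 2 \<in> {\<alpha> \<in> {0<..<1}. \<alpha> \<le> c}"
    using assms False by auto
  ultimately show ?thesis
    unfolding sup0_def by (metis empty_iff)
qed (auto simp: sup0_def)

theorem M_depth_eq_INF_M_cdf:
  fixes P :: "(real ^ 'd) measure"
  assumes "\<rho> \<in> loss_class" "P \<in> M_measures \<rho>"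
  shows "M_depth \<rho> z P = (INF u \<in> sphere 0 1. M_cdf \<rho> P u (u \<bullet> z))" (is "_ = ?I")
proof -
  have ne: "sphere (0 :: real ^ 'd) 1 \<noteq> {}"
    by simp
  have bdd: "bdd_below ((\<lambda>u. M_cdf \<rho> P u (u \<bullet> z)) ` sphere 0 1)"
    using M_cdf_bounds[OF assms] by (intro bdd_belowI[of _ 0]) auto
  have "z \<in> M_region \<rho> \<alpha> P \<longleftrightarrow> \<alpha> \<le> ?I" if "\<alpha> \<in> {0<..<1}" for \<alpha>
    unfolding le_cINF_iff[OF ne bdd] M_region_def M_halfspace_def
    using that by (simp add: M_quantile_le_iff[OF assms])
  then have "{\<alpha> \<in> {0<..<1}. z \<in> M_region \<rho> \<alpha> P} = {\<alpha> \<in> {0<..<1}. \<alpha> \<le> ?I}"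
    by blast
  moreover have "0 \<le> ?I"
    using M_cdf_bounds[OF assms] by (intro cINF_greatest ne)
  moreover obtain u :: "real ^ 'd" where "u \<in> sphere 0 1"
    using ne by blast
  then have "?I \<le> 1"
    using M_cdf_bounds(2)[OF assms] cINF_lower[OF bdd] order_trans by blast
  ultimately show ?thesis
    by (simp only: M_depth_def sup0_unit_interval)
qed

theorem theorem4p4:
  fixes \<rho> :: "real \<Rightarrow> real" and P :: "(real ^ 'd) measure" and z :: "real ^ 'd"
    and M :: "'a measure" and Z :: "'a \<Rightarrow> real ^ 'd"
  assumes "\<rho> \<in> loss_class"
    and "P \<in> M_measures \<rho>"
    and "prob_space M"
    and "Z \<in> borel_measurable M"
    and "distr M borel Z = P"
  shows "M_depth \<rho> z P =
    (INF u \<in> sphere 0 1.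
       (\<integral>\<omega>. \<bar>left_deriv \<rho> (u \<bullet> (Z \<omega> - z))\<bar> * indicator {\<omega>. u \<bullet> (Z \<omega> - z) \<le> 0} \<omega> \<partial>M)
       / (\<integral>\<omega>. \<bar>left_deriv \<rho> (u \<bullet> (Z \<omega> - z))\<bar> \<partial>M))"
proof -
  have [measurable]: "left_deriv \<rho> \<in> borel_measurable borel"
    using assms(1) by (intro borel_measurable_mono mono_left_deriv) (simp add: loss_class_def)
  note [measurable] = assms(4)
  have "M_cdf \<rho> P u (u \<bullet> z) =
       (\<integral>\<omega>. \<bar>left_deriv \<rho> (u \<bullet> (Z \<omega> - z))\<bar> * indicator {\<omega>. u \<bullet> (Z \<omega> - z) \<le> 0} \<omega> \<partial>M)
       / (\<integral>\<omega>. \<bar>left_deriv \<rho> (u \<bullet> (Z \<omega> - z))\<bar> \<partial>M)" for u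
    unfolding M_cdf_def assms(5)[symmetric]
    by (simp add: integral_distr inner_diff_right indicator_def)
  then show ?thesis
    by (simp add: M_depth_eq_INF_M_cdf[OF assms(1,2)])
qed

end
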